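(* The metric space $(\mathbf L/_{\mathbf O}, d_{\rm ABW})$ is an Alexandrov space with non-negative curvature.
   Context: Fix integers $d,T\ge 1$. Write matrices $A\in\mathbb R^{dT\times dT}$ in block form $A=(A_{s,t})_{s,t=1}^T$ with $A_{s,t}\in\mathbb R^{d\times d}$. $\mathbf L\subset\mathbb R^{dT\times dT}$ is the set of block-lower-triangular matrices ($L_{t,s}=0$ for $s>t$; the blocks $L_{t,s}\in\mathbb R^{d\times d}$ with $s\le t$ are arbitrary). $\mathbf O=\{\mathrm{diag}(O_1,\dots,O_T): O_t\in\mathbb R^{d\times d}\text{ orthogonal}\}\subset\mathbf L$. $\|\cdot\|_{\rm F}$ is the Frobenius norm. For $L,M\in\mathbf L$ set $d_{\rm ABW}(L,M)=\min_{O\in\mathbf O}\|L-MO\|_{\rm F}$ (this equals the adapted Wasserstein distance between the Gaussian processes $LG$ and $MG$, where $G=(G_1,\dots,G_T)$ are independent standard Gaussians in $\mathbb R^d$ generating the filtration). $\mathbf L/_{\mathbf O}$ is the quotient by $L\sim M\iff L=MO$ for some $O\in\mathbf O$ (equivalently $d_{\rm ABW}(L,M)=0$), equipped with the induced metric, again denoted $d_{\rm ABW}$. A curve $\gamma:[0,1]\to S$ in a metric space $(S,\rho)$ is a constant speed geodesic from $x$ to $y$ if $\gamma(0)=x$, $\gamma(1)=y$ and $\rho(\gamma(u),\gamma(v))=|u-v|\rho(x,y)$ for all $u,v\in[0,1]$; $(S,\rho)$ is geodesic if any two points are joined by such a curve. An Alexandrov space with non-negative curvature is a locally complete geodesic metric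 space $(S,\rho)$ such that for all $x,y,z\in S$, every constant speed geodesic $\gamma$ from $x$ to $y$ and every $u\in[0,1]$, $\rho^2(\gamma(u),z)\ge(1-u)\rho^2(x,z)+u\rho^2(y,z)-u(1-u)\rho^2(x,y)$. (Locally complete: every point has a neighbourhood that is complete.) *)

theory Defs
  imports "HOL-Analysis.Analysis"
begin

section \<open>Alexandrov spaces with non-negative curvature\<close>

context Metric_space
begin

definition const_speed_geodesic :: "(real \<Rightarrow> 'a) \<Rightarrow> 'a \<Rightarrow> 'a \<Rightarrow> bool" where
  "const_speed_geodesic \<gamma> x y \<longleftrightarrow>
     \<gamma> \<in> {0..1} \<rightarrow> M \<and> \<gamma> 0 = x \<and> \<gamma> 1 = y \<and>
     (\<forall>u\<in>{0..1}. \<forall>v\<in>{0..1}. d (\<gamma> u) (\<gamma> v) = \<bar>u - v\<bar> * d x y)"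

definition geodesic_space :: bool where
  "geodesic_space \<longleftrightarrow> (\<forall>x\<in>M. \<forall>y\<in>M. \<exists>\<gamma>. const_speed_geodesic \<gamma> x y)"

text \<open>Completeness of the neighbourhood \<open>N\<close> refers to the metric restricted to \<open>N\<close>.\<close>

definition locally_mcomplete :: bool where
  "locally_mcomplete \<longleftrightarrow>
     (\<forall>x\<in>M. \<exists>N\<subseteq>M. x \<in> mtopology interior_of N \<and> Metric_space.mcomplete N d)"

end

locale nonneg_curved_Alexandrov_space = Metric_space M d
  for M :: "'a set" and d :: "'a \<Rightarrow> 'a \<Rightarrow> real" +
  assumes locally_mcomplete: locally_mcomplete
    and geodesic_space: geodesic_space
    and nonneg_curvature:
      "\<And>x y z \<gamma> u. \<lbrakk>x \<in> M; y \<in> M; z \<in> M; const_speed_geodesic \<gamma> x y; u \<in> {0..1}\<rbrakk> \<Longrightarrow>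
         (d (\<gamma> u) z)\<^sup>2 \<ge> (1 - u) * (d x z)\<^sup>2 + u * (d y z)\<^sup>2 - u * (1 - u) * (d x y)\<^sup>2"


section \<open>Block matrices\<close>

text \<open>
  A \<open>dT \<times> dT\<close> matrix in block form has rows and columns indexed by pairs (block index, index
  within the block). The block indices \<open>1, \<dots>, T\<close> are represented by an arbitrary finite linear
  order \<open>'t\<close> with \<open>T = CARD('t)\<close>, and \<open>d = CARD('d)\<close>. The library norm on
  \<open>real^'n^'m\<close> is the Euclidean norm of the vector of all entries, i.e. the Frobenius norm.
\<close>

type_synonym ('d, 't) blockmat = "real^('t \<times> 'd)^('t \<times> 'd)"

definition blk :: "('d::finite, 't::finite) blockmat \<Rightarrow> 't \<Rightarrow> 't \<Rightarrow> real^'d^'d" where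
  "blk A s t = (\<chi> i j. A $ (s, i) $ (t, j))"

definition blkdiag :: "('t \<Rightarrow> real^'d^'d) \<Rightarrow> ('d::finite, 't::finite) blockmat" where
  "blkdiag Q = (\<chi> p q. if fst p = fst q then Q (fst p) $ snd p $ snd q else 0)"

definition block_lower :: "('d::finite, 't::{finite,linorder}) blockmat set" where
  "block_lower = {L. \<forall>t s. s > t \<longrightarrow> blk L t s = 0}"

definition block_orth :: "('d::finite, 't::finite) blockmat set" where
  "block_orth = {blkdiag Q |Q. \<forall>t. orthogonal_matrix (Q t)}"


section \<open>The adapted Bures-Wasserstein distance and the quotient space\<close>

text \<open>The infimum is a minimum, see \<open>abw_dist_attained\<close> below.\<close>

definition abw_dist ::
  "('d::finite, 't::finite) blockmat \<Rightarrow> ('d, 't) blockmat \<Rightarrow> real" where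
  "abw_dist L M = (INF Q\<in>block_orth. norm (L - M ** Q))"

definition abw_rel ::
  "(('d::finite, 't::{finite,linorder}) blockmat \<times> ('d, 't) blockmat) set" where
  "abw_rel = {(L, M). L \<in> block_lower \<and> M \<in> block_lower \<and> (\<exists>Q\<in>block_orth. L = M ** Q)}"

definition abw_space :: "('d::finite, 't::{finite,linorder}) blockmat set set" where
  "abw_space = block_lower // abw_rel"

text \<open>
  The choice of representatives is immaterial, see \<open>abw_qdist_class\<close> below.
\<close>

definition abw_qdist ::
  "('d::finite, 't::{finite,linorder}) blockmat set \<Rightarrow> ('d, 't) blockmat set \<Rightarrow> real" where
  "abw_qdist X Y = abw_dist (SOME L. L \<in> X) (SOME M. M \<in> Y)"


subsection \<open>Well-definedness\<close>

lemma blkdiag_mult: "blkdiag Q ** blkdiag R = blkdiag (\<lambda>t. Q t ** R t)"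
proof -
  have "(\<Sum>k\<in>UNIV. (if t = fst k then Q t $ i $ snd k else 0) *
           (if fst k = s then R (fst k) $ snd k $ j else 0)) =
        (if t = s then \<Sum>k\<in>UNIV. Q t $ i $ k * R t $ k $ j else 0)" (is "?l = ?r") for t s i j
  proof -
    have "?l = (\<Sum>a\<in>UNIV. \<Sum>b\<in>UNIV. (if t = a then Q t $ i $ b else 0) *
           (if a = s then R a $ b $ j else 0))"
      by (simp add: sum.cartesian_product case_prod_unfold flip: UNIV_Times_UNIV)
    also have "\<dots> = (\<Sum>a\<in>UNIV. if a = t then
        (if t = s then \<Sum>k\<in>UNIV. Q t $ i $ k * R t $ k $ j else 0) else 0)"
      by (intro sum.cong) auto
    also have "\<dots> = ?r" by simp
    finally show ?thesis .
  qed
  then show ?thesis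
    by (simp add: vec_eq_iff blkdiag_def matrix_matrix_mult_def)
qed

lemma blkdiag_transpose: "transpose (blkdiag Q) = blkdiag (\<lambda>t. transpose (Q t))"
  by (auto simp: vec_eq_iff blkdiag_def transpose_def)

lemma blkdiag_id: "blkdiag (\<lambda>t. mat 1) = mat 1"
  by (auto simp: vec_eq_iff blkdiag_def mat_def prod_eq_iff)

lemma block_orth_imp_orthogonal: "Q \<in> block_orth \<Longrightarrow> orthogonal_matrix Q"
  by (auto simp: block_orth_def orthogonal_matrix_def blkdiag_transpose blkdiag_mult blkdiag_id)

lemma block_orth_mult: "Q \<in> block_orth \<Longrightarrow> R \<in> block_orth \<Longrightarrow> Q ** R \<in> block_orth"
  by (force simp: block_orth_def blkdiag_mult intro: orthogonal_matrix_mul)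

lemma block_orth_transpose: "Q \<in> block_orth \<Longrightarrow> transpose Q \<in> block_orth"
  by (force simp: block_orth_def blkdiag_transpose)

lemma block_orth_id: "mat 1 \<in> block_orth"
  unfolding block_orth_def by (auto intro!: exI[of _ "\<lambda>t. mat 1"] simp: blkdiag_id orthogonal_matrix_id)

lemma norm_mult_orthogonal:
  fixes A :: "real^'n^'m"
  assumes "orthogonal_matrix Q"
  shows "norm (A ** Q) = norm A"
proof -
  have row: "(A ** Q) $ i = transpose Q *v (A $ i)" for i
    by (simp add: vec_eq_iff matrix_matrix_mult_def matrix_vector_mult_def transpose_def mult.commute)
  have "orthogonal_transformation ((*v) (transpose Q))"
    using assms by (simp add: orthogonal_transformation_matrix)
  then have "norm ((A ** Q) $ i) = norm (A $ i)" for i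
    by (simp add: row orthogonal_transformation)
  then show ?thesis by (simp add: norm_vec_def)
qed

lemma compact_block_orth: "compact (block_orth :: ('d::finite, 't::finite) blockmat set)"
proof -
  have eq: "(block_orth :: ('d, 't) blockmat set) =
     {A. transpose A ** A = mat 1} \<inter> {A. \<forall>s t i j. s \<noteq> t \<longrightarrow> A $ (s, i) $ (t, j) = 0}" (is "_ = ?R")
  proof (intro equalityI subsetI)
    fix A :: "('d, 't) blockmat" assume "A \<in> block_orth"
    then show "A \<in> ?R"
      using block_orth_imp_orthogonal[of A]
      by (auto simp: orthogonal_matrix block_orth_def blkdiag_def)
  next
    fix A :: "('d, 't) blockmat" assume A: "A \<in> ?R"
    have Ad: "A = blkdiag (\<lambda>t. blk A t t)"
      using A by (auto simp: vec_eq_iff blkdiag_def blk_def)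
    have "blkdiag (\<lambda>t. transpose (blk A t t) ** blk A t t) = transpose A ** A"
      by (subst (3 4) Ad) (simp only: blkdiag_mult blkdiag_transpose)
    also have "\<dots> = mat 1" using A by blast
    finally have "blkdiag (\<lambda>t. transpose (blk A t t) ** blk A t t) = mat 1" .
    then have e: "blkdiag (\<lambda>t. transpose (blk A t t) ** blk A t t) $ (t, i) $ (t, j) =
        (mat 1 :: ('d, 't) blockmat) $ (t, i) $ (t, j)" for t i j by simp
    have "transpose (blk A t t) ** blk A t t = mat 1" for t
      using e[of t] by (simp add: vec_eq_iff blkdiag_def mat_def)
    then have "orthogonal_matrix (blk A t t)" for t by (simp add: orthogonal_matrix)
    then show "A \<in> block_orth" using Ad unfolding block_orth_def by blast
  qed
  have "closed {A :: ('d, 't) blockmat. transpose A ** A = mat 1}"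
    unfolding transpose_def matrix_matrix_mult_def
    by (intro closed_Collect_eq continuous_intros)
  moreover have "closed {A :: ('d, 't) blockmat. \<forall>s t i j. s \<noteq> t \<longrightarrow> A $ (s, i) $ (t, j) = 0}"
    by (intro closed_Collect_all closed_Collect_imp open_Collect_const closed_Collect_eq continuous_intros)
  ultimately have "closed (block_orth :: ('d, 't) blockmat set)"
    unfolding eq by (rule closed_Int)
  moreover have "norm A \<le> norm (mat 1 :: ('d, 't) blockmat)" if "A \<in> block_orth"
    for A :: "('d, 't) blockmat"
    using norm_mult_orthogonal[OF block_orth_imp_orthogonal[OF that], of "mat 1"] by simp
  then have "bounded (block_orth :: ('d, 't) blockmat set)" by (auto simp: bounded_iff)
  ultimately show ?thesis by (simp add: compact_eq_bounded_closed)
qed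

lemma abw_dist_attained:
  "\<exists>Q\<in>block_orth. abw_dist L M = norm (L - M ** Q) \<and>
     (\<forall>R\<in>block_orth. norm (L - M ** Q) \<le> norm (L - M ** R))"
proof -
  have "continuous_on block_orth (\<lambda>Q. norm (L - M ** Q))"
    unfolding matrix_matrix_mult_def by (intro continuous_intros)
  from continuous_attains_inf[OF compact_block_orth _ this] block_orth_id
  obtain Q where Q: "Q \<in> block_orth" "\<forall>R\<in>block_orth. norm (L - M ** Q) \<le> norm (L - M ** R)"
    by blast
  have "abw_dist L M = norm (L - M ** Q)"
    unfolding abw_dist_def using Q by (intro cInf_eq_minimum) auto
  with Q show ?thesis by blast
qed

lemma abw_dist_le: "Q \<in> block_orth \<Longrightarrow> abw_dist L M \<le> norm (L - M ** Q)"
  using abw_dist_attained[of L M] by auto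

lemma abw_dist_mult_le:
  assumes "Q \<in> block_orth" "R \<in> block_orth"
  shows "abw_dist (L ** Q) (M ** R) \<le> abw_dist L M"
proof -
  obtain S where S: "S \<in> block_orth" "abw_dist L M = norm (L - M ** S)"
    using abw_dist_attained[of L M] by blast
  have "R ** transpose R = mat 1"
    using assms block_orth_imp_orthogonal orthogonal_matrix_def by blast
  then have "(M ** R) ** (transpose R ** S ** Q) = M ** S ** Q"
    by (metis matrix_mul_assoc matrix_mul_rid)
  then have "L ** Q - (M ** R) ** (transpose R ** S ** Q) = (L - M ** S) ** Q"
    by (simp add: vec_eq_iff matrix_matrix_mult_def sum_subtractf left_diff_distrib)
  then have "norm (L ** Q - (M ** R) ** (transpose R ** S ** Q)) = norm (L - M ** S)"
    using norm_mult_orthogonal[OF block_orth_imp_orthogonal[OF assms(1)]] by metis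
  with S abw_dist_le[of "transpose R ** S ** Q" "L ** Q" "M ** R"] show ?thesis
    using assms by (simp add: block_orth_mult block_orth_transpose)
qed

lemma abw_dist_mult:
  assumes "Q \<in> block_orth" "R \<in> block_orth"
  shows "abw_dist (L ** Q) (M ** R) = abw_dist L M"
proof (rule antisym)
  show "abw_dist (L ** Q) (M ** R) \<le> abw_dist L M"
    using assms by (rule abw_dist_mult_le)
  have "Q ** transpose Q = mat 1" "R ** transpose R = mat 1"
    using assms block_orth_imp_orthogonal orthogonal_matrix_def by blast+
  then have "L ** Q ** transpose Q = L" "M ** R ** transpose R = M"
    by (metis matrix_mul_assoc matrix_mul_rid)+
  then show "abw_dist L M \<le> abw_dist (L ** Q) (M ** R)"
    using abw_dist_mult_le[of "transpose Q" "transpose R" "L ** Q" "M ** R"] assms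
    by (simp add: block_orth_transpose)
qed

lemma equiv_abw_rel: "equiv block_lower abw_rel"
proof (rule equivI)
  show "abw_rel \<subseteq> block_lower \<times> block_lower" by (auto simp: abw_rel_def)
  show "refl_on block_lower abw_rel"
    using block_orth_id by (force simp: refl_on_def abw_rel_def)
  show "sym abw_rel"
  proof (rule symI)
    fix L M :: "('d::finite, 't::{finite,linorder}) blockmat" assume "(L, M) \<in> abw_rel"
    then obtain Q where Q: "Q \<in> block_orth" "L = M ** Q" "L \<in> block_lower" "M \<in> block_lower"
      by (auto simp: abw_rel_def)
    then have "M = L ** transpose Q"
      by (metis block_orth_imp_orthogonal orthogonal_matrix_def matrix_mul_assoc matrix_mul_rid)
    with Q block_orth_transpose show "(M, L) \<in> abw_rel" unfolding abw_rel_def by blast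
  qed
  show "trans abw_rel"
  proof (rule transI)
    fix L M N :: "('d::finite, 't::{finite,linorder}) blockmat"
    assume "(L, M) \<in> abw_rel" "(M, N) \<in> abw_rel"
    then obtain Q R where "Q \<in> block_orth" "R \<in> block_orth" "L = M ** Q" "M = N ** R"
      "L \<in> block_lower" "N \<in> block_lower"
      by (auto simp: abw_rel_def)
    then show "(L, N) \<in> abw_rel" unfolding abw_rel_def
      by (auto intro!: bexI[of _ "R ** Q"] simp: block_orth_mult matrix_mul_assoc)
  qed
qed

lemma abw_qdist_class:
  fixes L M :: "('d::finite, 't::{finite,linorder}) blockmat"
  assumes "L \<in> block_lower" "M \<in> block_lower"
  shows "abw_qdist (abw_rel `` {L}) (abw_rel `` {M}) = abw_dist L M"
proof -
  have rep: "\<exists>Q\<in>block_orth. N = (SOME N'. N' \<in> abw_rel `` {N}) ** Q" if "N \<in> block_lower"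
    for N :: "('d, 't) blockmat"
  proof -
    have "(SOME N'. N' \<in> abw_rel `` {N}) \<in> abw_rel `` {N}"
      using equiv_class_self[OF equiv_abw_rel that] by (rule someI)
    then show ?thesis by (auto simp: abw_rel_def)
  qed
  from rep[OF assms(1)] rep[OF assms(2)] show ?thesis
    unfolding abw_qdist_def by (metis abw_dist_mult)
qed

end

theory Submission
  imports Defs
begin

text \<open>
  The projection from the Euclidean space of block-lower-triangular matrices to the quotient is
  1-Lipschitz, and since block-orthogonal matrices act by isometries, distances in the quotient
  are realised by representatives with one of the two representatives prescribed. Such a map
  transports geodesics, completeness and the curvature bound to the quotient. For the curvature
  bound at a point of a geodesic from \<open>x\<close> to \<open>y\<close>, fix a representative \<open>P\<close> of this point and choose
  representatives of \<open>x\<close>, \<open>y\<close>, \<open>z\<close> at optimal distance from \<open>P\<close>. Then \<open>P\<close> has to lie on the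
  segment between the first two, and the Euclidean identity for this segment gives the bound.
\<close>

text \<open>Since each block is multiplied separately, zero blocks stay zero; hence block-orthogonal
  matrices act on \<open>block_lower\<close> from the right.\<close>

lemma blk_mult_blkdiag: "blk (L ** blkdiag Q) t s = blk L t s ** Q s"
proof -
  have "(\<Sum>k\<in>UNIV. L $ (t, i) $ k * (if fst k = s then Q (fst k) $ snd k $ j else 0)) =
        (\<Sum>k\<in>UNIV. L $ (t, i) $ (s, k) * Q s $ k $ j)" (is "?l = ?r") for i j
  proof -
    have "?l = (\<Sum>a\<in>UNIV. \<Sum>b\<in>UNIV. L $ (t, i) $ (a, b) * (if a = s then Q a $ b $ j else 0))"
      by (simp add: sum.cartesian_product case_prod_unfold flip: UNIV_Times_UNIV)
    also have "\<dots> = (\<Sum>a\<in>UNIV. if a = s then \<Sum>b\<in>UNIV. L $ (t, i) $ (s, b) * Q s $ b $ j else 0)"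
      by (intro sum.cong) auto
    also have "\<dots> = ?r" by simp
    finally show ?thesis .
  qed
  then show ?thesis
    by (simp add: vec_eq_iff blk_def blkdiag_def matrix_matrix_mult_def)
qed

lemma block_lower_mult: "L \<in> block_lower \<Longrightarrow> Q \<in> block_orth \<Longrightarrow> L ** Q \<in> block_lower"
  by (auto simp: block_lower_def block_orth_def blk_mult_blkdiag)

text \<open>Used twice: segments between representatives stay in \<open>block_lower\<close>, and so
  do limits, as subspaces of a Euclidean space are closed.\<close>

lemma subspace_block_lower: "subspace block_lower"
  by (auto simp: subspace_def block_lower_def blk_def vec_eq_iff)

lemma abw_dist_nonneg: "0 \<le> abw_dist L M"
  using abw_dist_attained[of L M] by auto

lemma abw_dist_commute:
  fixes L M :: "('d::finite, 't::finite) blockmat"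
  shows "abw_dist L M = abw_dist M L"
proof -
  have "abw_dist L M \<le> abw_dist M L" for L M :: "('d, 't) blockmat"
  proof -
    obtain Q where Q: "Q \<in> block_orth" "abw_dist M L = norm (M - L ** Q)"
      using abw_dist_attained[of M L] by blast
    \<comment> \<open>Invariance allows acting on the left argument alone; the factor
      \<open>mat 1\<close> only brings the right argument into the required form.\<close>
    have "abw_dist L M = abw_dist (L ** Q) (M ** mat 1)"
      by (rule abw_dist_mult[symmetric]) (auto simp: Q block_orth_id)
    also have "\<dots> \<le> norm (L ** Q - M ** mat 1 ** mat 1)"
      by (intro abw_dist_le block_orth_id)
    finally show ?thesis by (simp add: Q norm_minus_commute)
  qed
  then show ?thesis by (intro antisym)
qed

lemma abw_space_subset: "X \<in> abw_space \<Longrightarrow> X \<subseteq> block_lower"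
  unfolding abw_space_def quotient_def abw_rel_def by auto

lemma abw_space_class: "X \<in> abw_space \<Longrightarrow> L \<in> X \<Longrightarrow> X = abw_rel `` {L}"
  unfolding abw_space_def by (erule quotientE) (use equiv_class_eq[OF equiv_abw_rel] in auto)

lemma abw_space_nonempty: "X \<in> abw_space \<Longrightarrow> \<exists>L. L \<in> X"
  unfolding abw_space_def using in_quotient_imp_non_empty[OF equiv_abw_rel] by blast

lemma abw_class_in_space: "L \<in> block_lower \<Longrightarrow> abw_rel `` {L} \<in> abw_space"
  unfolding abw_space_def by (rule quotientI)

lemma abw_class_self: "L \<in> block_lower \<Longrightarrow> L \<in> abw_rel `` {L}"
  by (rule equiv_class_self[OF equiv_abw_rel])

text \<open>Frees later arguments from the \<open>SOME\<close> in \<open>abw_qdist\<close>: any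
  members of the two classes may be used.\<close>

lemma abw_qdist_eq:
  assumes "X \<in> abw_space" "Y \<in> abw_space" "L \<in> X" "M \<in> Y"
  shows "abw_qdist X Y = abw_dist L M"
proof -
  have "L \<in> block_lower" "M \<in> block_lower"
    using assms abw_space_subset by auto
  then show ?thesis
    using abw_qdist_class[of L M] abw_space_class[OF assms(1,3)] abw_space_class[OF assms(2,4)] by simp
qed

lemma abw_qdist_le:
  assumes "X \<in> abw_space" "Y \<in> abw_space" "L \<in> X" "M \<in> Y"
  shows "abw_qdist X Y \<le> norm (L - M)"
  using abw_dist_le[OF block_orth_id, of L M] by (simp add: abw_qdist_eq[OF assms])

text \<open>The minimising \<open>Q\<close> is absorbed into the representative:
  \<open>N ** Q\<close> lies in the same class as \<open>N\<close>. Prescribing \<open>L\<close> is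
  what allows several optimal representatives to be aligned with one matrix.\<close>

lemma abw_qdist_realised:
  assumes "X \<in> abw_space" "Y \<in> abw_space" "L \<in> X"
  obtains M where "M \<in> Y" "abw_qdist X Y = norm (L - M)"
proof -
  obtain N where N: "N \<in> Y" using abw_space_nonempty assms by blast
  obtain Q where Q: "Q \<in> block_orth" "abw_dist L N = norm (L - N ** Q)"
    using abw_dist_attained[of L N] by blast
  have NL: "N \<in> block_lower" using N abw_space_subset[OF assms(2)] by blast
  then have "(N ** Q, N) \<in> abw_rel"
    using Q block_lower_mult unfolding abw_rel_def by blast
  then have "(N, N ** Q) \<in> abw_rel"
    using equivE[OF equiv_abw_rel] by (metis symD)
  then have "N ** Q \<in> Y" using abw_space_class[OF assms(2) N] by blast
  then show ?thesis
    using that Q abw_qdist_eq[OF assms N] by simp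
qed

lemma Metric_space_abw:
  "Metric_space (abw_space :: ('d::finite, 't::{finite,linorder}) blockmat set set) abw_qdist"
proof
  fix X Y Z :: "('d, 't) blockmat set"
  show "0 \<le> abw_qdist X Y" by (simp add: abw_qdist_def abw_dist_nonneg)
  show "abw_qdist X Y = abw_qdist Y X" unfolding abw_qdist_def by (rule abw_dist_commute)
  show "abw_qdist X Y = 0 \<longleftrightarrow> X = Y" if X: "X \<in> abw_space" and Y: "Y \<in> abw_space"
  proof -
    obtain L where L: "L \<in> X" using X abw_space_nonempty by blast
    obtain M where M: "M \<in> Y" "abw_qdist X Y = norm (L - M)"
      using abw_qdist_realised[OF X Y L] .
    have "abw_qdist X X = 0"
      using abw_qdist_le[OF X X L L] by (simp add: abw_qdist_def abw_dist_nonneg order.antisym)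
    moreover have "X = Y" if "abw_qdist X Y = 0"
      using that L M abw_space_class[OF X L] abw_space_class[OF Y M(1)] by simp
    ultimately show ?thesis by blast
  qed
  show "abw_qdist X Z \<le> abw_qdist X Y + abw_qdist Y Z"
    if X: "X \<in> abw_space" and Y: "Y \<in> abw_space" and Z: "Z \<in> abw_space"
  proof -
    obtain L where L: "L \<in> X" using X abw_space_nonempty by blast
    obtain M where M: "M \<in> Y" "abw_qdist X Y = norm (L - M)"
      using abw_qdist_realised[OF X Y L] .
    \<comment> \<open>Starting from the same \<open>M\<close> lets the two differences telescope to
      \<open>L - N\<close>.\<close>
    obtain N where N: "N \<in> Z" "abw_qdist Y Z = norm (M - N)"
      using abw_qdist_realised[OF Y Z M(1)] .
    have "abw_qdist X Z \<le> norm ((L - M) + (M - N))"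
      using abw_qdist_le[OF X Z L N(1)] by simp
    also have "\<dots> \<le> abw_qdist X Y + abw_qdist Y Z"
      unfolding M N by (rule norm_triangle_ineq)
    finally show ?thesis .
  qed
qed

global_interpretation abw: Metric_space abw_space abw_qdist
  by (rule Metric_space_abw)

text \<open>Representatives of a Cauchy sequence need not form a Cauchy sequence, but suitable ones
  are bounded. Finite dimension then yields a convergent subsequence, which suffices for a Cauchy
  sequence.\<close>

lemma mcomplete_abw:
  "Metric_space.mcomplete (abw_space :: ('d::finite, 't::{finite,linorder}) blockmat set set) abw_qdist"
  unfolding abw.mcomplete_def
proof (intro allI impI)
  fix \<sigma> :: "nat \<Rightarrow> ('d, 't) blockmat set"
  assume C: "abw.MCauchy \<sigma>"
  then have \<sigma>: "\<sigma> n \<in> abw_space" for n by (auto simp: abw.MCauchy_def)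
  obtain L where L: "L \<in> \<sigma> 0" using \<sigma> abw_space_nonempty by blast
  \<comment> \<open>All representatives are aligned with the fixed \<open>L\<close>, so a bound on
    the distances to \<open>\<sigma> 0\<close> bounds their norms.\<close>
  define R where "R n = (SOME M. M \<in> \<sigma> n \<and> abw_qdist (\<sigma> 0) (\<sigma> n) = norm (L - M))" for n
  have R: "R n \<in> \<sigma> n \<and> abw_qdist (\<sigma> 0) (\<sigma> n) = norm (L - R n)" for n
    unfolding R_def by (rule someI_ex) (meson abw_qdist_realised \<sigma> L)
  obtain B where B: "abw_qdist (\<sigma> 0) (\<sigma> n) \<le> B" for n
    using abw.MCauchy_imp_mbounded[OF C] by (auto simp: abw.mbounded_alt)
  have "bounded (range R)"
    by (rule boundedI[where B = "norm L + B"])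
       (use R B in \<open>smt (verit, best) imageE norm_triangle_sub norm_minus_commute\<close>)
  then obtain l r where r: "strict_mono r" "(R \<circ> r) \<longlonglongrightarrow> l"
    using bounded_imp_convergent_subsequence by metis
  have RL: "(R \<circ> r) n \<in> block_lower" for n
    using R \<sigma> abw_space_subset by fastforce
  have l: "l \<in> block_lower"
    by (rule closed_sequentially[OF closed_subspace[OF subspace_block_lower] RL r(2)])
  define X where "X = abw_rel `` {l}"
  have X: "X \<in> abw_space" "l \<in> X"
    unfolding X_def by (fact abw_class_in_space[OF l] abw_class_self[OF l])+
  have "(\<lambda>n. norm ((R \<circ> r) n - l)) \<longlonglongrightarrow> 0"
    by (intro tendsto_norm_zero LIM_zero r(2))
  then have "(\<lambda>n. abw_qdist ((\<sigma> \<circ> r) n) X) \<longlonglongrightarrow> 0"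
    by (rule tendsto_sandwich[rotated 2, OF tendsto_const])
       (use R \<sigma> X in \<open>auto intro!: always_eventually abw_qdist_le\<close>)
  then have "limitin abw.mtopology (\<sigma> \<circ> r) X sequentially"
    using \<sigma> X by (simp add: abw.limitin_metric_dist_null)
  then show "\<exists>X. limitin abw.mtopology \<sigma> X sequentially"
    using abw.MCauchy_convergent_subsequence[OF C r(1)] by blast
qed

text \<open>The geodesic is the projection of the straight segment between two optimally aligned
  representatives.\<close>

lemma abw_geodesic_space:
  "Metric_space.geodesic_space (abw_space :: ('d::finite, 't::{finite,linorder}) blockmat set set) abw_qdist"
  unfolding abw.geodesic_space_def
proof (intro ballI)
  fix X Y :: "('d, 't) blockmat set"
  assume X: "X \<in> abw_space" and Y: "Y \<in> abw_space"
  obtain L where L: "L \<in> X" using X abw_space_nonempty by blast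
  obtain M where M: "M \<in> Y" "abw_qdist X Y = norm (L - M)"
    using abw_qdist_realised[OF X Y L] .
  define D where "D = abw_qdist X Y"
  define g where "g u = (1 - u) *\<^sub>R L + u *\<^sub>R M" for u :: real
  define \<gamma> where "\<gamma> u = abw_rel `` {g u}" for u
  have "L \<in> block_lower" "M \<in> block_lower"
    using L M X Y abw_space_subset by blast+
  then have g: "g u \<in> block_lower" for u
    unfolding g_def by (intro subspace_add subspace_scale subspace_block_lower)
  have \<gamma>: "\<gamma> u \<in> abw_space" "g u \<in> \<gamma> u" for u
    unfolding \<gamma>_def by (fact abw_class_in_space[OF g] abw_class_self[OF g])+
  have ends: "\<gamma> 0 = X" "\<gamma> 1 = Y"
    using abw_space_class[OF X L] abw_space_class[OF Y M(1)] by (simp_all add: \<gamma>_def g_def)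
  have up: "abw_qdist (\<gamma> u) (\<gamma> v) \<le> \<bar>u - v\<bar> * D" for u v
  proof -
    have "g u - g v = (v - u) *\<^sub>R (L - M)" by (simp add: g_def algebra_simps)
    then have "norm (g u - g v) = \<bar>u - v\<bar> * D" by (simp add: D_def M abs_minus_commute)
    then show ?thesis using abw_qdist_le[OF \<gamma>(1) \<gamma>(1) \<gamma>(2) \<gamma>(2), of u v] by simp
  qed
  have eq: "abw_qdist (\<gamma> u) (\<gamma> v) = (v - u) * D" if "0 \<le> u" "u \<le> v" "v \<le> 1" for u v
  proof (rule antisym)
    show "abw_qdist (\<gamma> u) (\<gamma> v) \<le> (v - u) * D" using up[of u v] that by simp
    \<comment> \<open>No pair on the curve can be closer than \<open>up\<close> permits: a shortcut
      would join \<open>X\<close> to \<open>Y\<close> by a path shorter than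
      \<open>D\<close>.\<close>
    have "D \<le> abw_qdist (\<gamma> 0) (\<gamma> u) + abw_qdist (\<gamma> u) (\<gamma> v) + abw_qdist (\<gamma> v) (\<gamma> 1)"
      using abw.triangle[of "\<gamma> 0" "\<gamma> u" "\<gamma> 1"] abw.triangle[of "\<gamma> u" "\<gamma> v" "\<gamma> 1"] \<gamma>
      by (simp add: ends D_def X Y)
    also have "\<dots> \<le> u * D + abw_qdist (\<gamma> u) (\<gamma> v) + (1 - v) * D"
      using up[of 0 u] up[of v 1] that by simp
    finally show "(v - u) * D \<le> abw_qdist (\<gamma> u) (\<gamma> v)" by (simp add: algebra_simps)
  qed
  have "abw_qdist (\<gamma> u) (\<gamma> v) = \<bar>u - v\<bar> * D" if "u \<in> {0..1}" "v \<in> {0..1}" for u v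
  proof (cases "u \<le> v")
    case True
    then show ?thesis using eq[of u v] that by simp
  next
    case False
    then show ?thesis using eq[of v u] that by (simp add: abw.commute[of "\<gamma> u" "\<gamma> v"])
  qed
  then show "\<exists>\<gamma>. abw.const_speed_geodesic \<gamma> X Y"
    using \<gamma>(1) ends by (intro exI[of _ \<gamma>]) (simp add: abw.const_speed_geodesic_def D_def)
qed

text \<open>Serves the curvature bound twice: to place \<open>P\<close> on the segment from
  \<open>L\<close> to \<open>M\<close>, and to expand its squared distance to
  \<open>N\<close>.\<close>

lemma power2_norm_convex_combination:
  fixes a b :: "'a::real_inner"
  shows "(norm ((1 - u) *\<^sub>R a + u *\<^sub>R b))\<^sup>2 =
    (1 - u) * (norm a)\<^sup>2 + u * (norm b)\<^sup>2 - u * (1 - u) * (norm (a - b))\<^sup>2"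
  unfolding power2_norm_eq_inner
  by (simp add: inner_add_left inner_add_right inner_diff_left inner_diff_right inner_commute[of b a]
      algebra_simps)

lemma abw_nonneg_curvature:
  assumes X: "X \<in> abw_space" and Y: "Y \<in> abw_space" and Z: "Z \<in> abw_space"
    and \<gamma>: "abw.const_speed_geodesic \<gamma> X Y" and u: "u \<in> {0..1}"
  shows "(abw_qdist (\<gamma> u) Z)\<^sup>2 \<ge>
    (1 - u) * (abw_qdist X Z)\<^sup>2 + u * (abw_qdist Y Z)\<^sup>2 - u * (1 - u) * (abw_qdist X Y)\<^sup>2"
proof -
  define D where "D = abw_qdist X Y"
  have u01: "0 \<le> u" "0 \<le> 1 - u" using u by auto
  have G: "\<gamma> u \<in> abw_space" using \<gamma> u by (auto simp: abw.const_speed_geodesic_def)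
  have dist: "abw_qdist (\<gamma> u) (\<gamma> v) = \<bar>u - v\<bar> * D" if "v \<in> {0..1}" for v
    using \<gamma> u that by (auto simp: abw.const_speed_geodesic_def D_def)
  have ends: "\<gamma> 0 = X" "\<gamma> 1 = Y" using \<gamma> by (auto simp: abw.const_speed_geodesic_def)
  obtain P where P: "P \<in> \<gamma> u" using G abw_space_nonempty by blast
  obtain L where L: "L \<in> X" "abw_qdist (\<gamma> u) X = norm (P - L)"
    using abw_qdist_realised[OF G X P] .
  obtain M where M: "M \<in> Y" "abw_qdist (\<gamma> u) Y = norm (P - M)"
    using abw_qdist_realised[OF G Y P] .
  obtain N where N: "N \<in> Z" "abw_qdist (\<gamma> u) Z = norm (P - N)"
    using abw_qdist_realised[OF G Z P] .
  have PL: "norm (P - L) = u * D" and PM: "norm (P - M) = (1 - u) * D"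
    using dist[of 0] dist[of 1] u L M ends by auto
  \<comment> \<open>\<open>L\<close> and \<open>M\<close> were aligned with \<open>P\<close>, not
    with each other. Going through \<open>P\<close> gives at most \<open>D\<close>, the projection
    at least \<open>D\<close>, so they are optimally aligned all the same.\<close>
  have "norm (L - M) \<le> norm (P - L) + norm (P - M)"
    using norm_triangle_ineq4[of "P - M" "P - L"] by simp
  then have LM: "norm (L - M) = D"
    using abw_qdist_le[OF X Y L(1) M(1)] unfolding PL PM D_def[symmetric]
    by (simp add: algebra_simps)
  \<comment> \<open>With norms \<open>u * D\<close>, \<open>(1 - u) * D\<close> and
    \<open>D\<close>, the identity reduces to
    \<open>u * (1 - u) * D\<^sup>2 * (u + (1 - u) - 1)\<close>.\<close>
  have "(norm ((1 - u) *\<^sub>R (P - L) + u *\<^sub>R (P - M)))\<^sup>2 = 0"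
    unfolding power2_norm_convex_combination
    by (simp add: PL PM norm_minus_commute[of M L] LM power2_eq_square algebra_simps)
  then have P_eq: "P = (1 - u) *\<^sub>R L + u *\<^sub>R M"
    by (simp add: algebra_simps)
  have "P - N = (1 - u) *\<^sub>R (L - N) + u *\<^sub>R (M - N)"
    unfolding P_eq by (simp add: algebra_simps)
  then have "(norm (P - N))\<^sup>2 =
      (1 - u) * (norm (L - N))\<^sup>2 + u * (norm (M - N))\<^sup>2 - u * (1 - u) * D\<^sup>2"
    using power2_norm_convex_combination[of u "L - N" "M - N"] by (simp add: LM)
  \<comment> \<open>\<open>N\<close> is optimal for \<open>P\<close> only; for \<open>L\<close> and
    \<open>M\<close> an inequality remains, in the direction that a lower bound requires.\<close>
  moreover have "(abw_qdist X Z)\<^sup>2 \<le> (norm (L - N))\<^sup>2" "(abw_qdist Y Z)\<^sup>2 \<le> (norm (M - N))\<^sup>2"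
    using X Y Z L M N by (auto intro!: power_mono abw_qdist_le)
  ultimately show ?thesis
    using u01 by (simp add: N D_def add_mono mult_left_mono)
qed

text \<open>By global completeness, the whole space serves as the neighbourhood of every
  point.\<close>

lemma abw_locally_mcomplete:
  "Metric_space.locally_mcomplete (abw_space :: ('d::finite, 't::{finite,linorder}) blockmat set set) abw_qdist"
  unfolding abw.locally_mcomplete_def
proof
  fix X :: "('d, 't) blockmat set"
  assume "X \<in> abw_space"
  then show "\<exists>N\<subseteq>abw_space. X \<in> abw.mtopology interior_of N \<and> Metric_space.mcomplete N abw_qdist"
    by (intro exI[of _ abw_space]) (simp add: mcomplete_abw interior_of_openin)
qed

theorem theorem1p4:
  shows "nonneg_curved_Alexandrov_space
           (abw_space :: ('d::finite, 't::{finite,linorder}) blockmat set set) abw_qdist"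
proof (intro nonneg_curved_Alexandrov_space.intro nonneg_curved_Alexandrov_space_axioms.intro)
qed (rule Metric_space_abw abw_locally_mcomplete abw_geodesic_space abw_nonneg_curvature; assumption)+

end
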